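(* Let $0<\delta\le1$, let $m$ be an integer with $m\le\frac{n}{9\ln(2n/\delta)}$, let $D_{\mathcal X}$ be a probability distribution on $\mathcal X$, and let $q\in\mathcal Q$. If a mechanism $M:\mathcal X^n\times\mathcal Q\to\mathcal R$ has a compression scheme of size $m$ with respect to $q$, then it is $(\epsilon,\delta)$-LSS with respect to $q$ and the product distribution over $\mathcal X^n$ induced by $D_{\mathcal X}$ (i.e. $n$ i.i.d. samples from $D_{\mathcal X}$), for any $\epsilon>11\sqrt{\frac{m\ln(2n/\delta)}{n}}$.
   Context: $\mathcal X$, $\mathcal Q$, $\mathcal R$ are countable sets and $n\in\mathbb N$. A mechanism is a possibly randomized function $M:\mathcal X^n\times\mathcal Q\to\mathcal R$. Compression scheme: for an integer $m<n/2$, $M$ has a compression scheme of size $m$ with respect to $q$ if $M(\cdot,q)=f_q\circ g_q$, where $g_q:\mathcal X^n\to\mathcal X^m$ (the compression function) satisfies $g_q(s)\subset s$, i.e. $g_q(s)$ consists of $m$ of the $n$ elements of $s$ (as a sub-multiset), and $f_q:\mathcal X^m\to\mathcal R$ (the encoding function) is arbitrary. Both functions may be randomized (with $f_q$'s randomness independent of the rest given its input). LSS: for a distribution $D_{\mathcal X^n}$ on $\mathcal X^n$ and fixed $q$ write $D(s)=D_{\mathcal X^n}(s)$, $D(r\mid s)=\Pr[M(s,q)=r]$, $D(r)=\sum_sD(s)D(r\mid s)$, $D(s\mid r)=D(s)D(r\mid s)/D(r)$, $D(x\mid s)=\frac1n|\{i:s_i=x\}|$, $D(x)=\sum_sD(s)D(x\mid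 s)$, $D(x\mid r)=\sum_sD(s\mid r)D(x\mid s)$ (only $r$ with $D(r)>0$ matter). With stability loss $\ell(r)=\sum_{x:\,D(x\mid r)>D(x)}(D(x\mid r)-D(x))$, $M$ is $(\epsilon,\delta)$-LSS with respect to $D_{\mathcal X^n},q$ if for every $\mathbf r\subseteq\mathcal R$, $\sum_{r\in\mathbf r}D(r)(\ell(r)-\epsilon)\le\delta$ (trivially true for $\epsilon\ge1$, as $\ell\le1$). *)

theory Defs
  imports "HOL-Probability.Probability"
begin

text \<open>
  The countable sets are types of class \<open>countable\<close>. An element of the \<open>n\<close>-fold power of
  \<open>'x\<close> is a list of length \<open>n\<close>. A randomized mechanism maps a sample and a query to the
  distribution of its output; its values on lists of other lengths play no role.
\<close>

type_synonym ('x, 'q, 'r) mechanism = "'x list \<Rightarrow> 'q \<Rightarrow> 'r pmf"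

definition samples :: "nat \<Rightarrow> 'x list set" where
  "samples n = {s. length s = n}"

text \<open>
  The compression function \<open>g\<close> and the encoding function \<open>f\<close> are both randomized, and
  \<^const>\<open>bind_pmf\<close> draws the coins of \<open>f\<close> independently of everything else given its input.
\<close>

definition has_compression_scheme ::
    "nat \<Rightarrow> ('x, 'q, 'r) mechanism \<Rightarrow> nat \<Rightarrow> 'q \<Rightarrow> bool" where
  "has_compression_scheme n M m q \<longleftrightarrow>
     real m < real n / 2 \<and>
     (\<exists>(g :: 'x list \<Rightarrow> 'x list pmf) (f :: 'x list \<Rightarrow> 'r pmf).
        \<forall>s\<in>samples n.
          (\<forall>t\<in>set_pmf (g s). t \<in> samples m \<and> mset t \<subseteq># mset s) \<and>
          M s q = bind_pmf (g s) f)"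

text \<open>
  In the names below, \<open>s\<close>, \<open>r\<close>, \<open>x\<close> stand for sample, response and element; for instance
  \<open>prob_x_given_r\<close> is \<open>D(x | r)\<close>. For \<open>D(r) = 0\<close> division by zero makes \<open>D(s | r) = 0\<close>; such
  responses have weight zero in the definition of LSS.
\<close>

definition prob_r ::
    "nat \<Rightarrow> ('x, 'q, 'r) mechanism \<Rightarrow> 'x list pmf \<Rightarrow> 'q \<Rightarrow> 'r \<Rightarrow> real" where
  "prob_r n M D q r = (\<Sum>\<^sub>\<infinity>s\<in>samples n. pmf D s * pmf (M s q) r)"

definition prob_s_given_r ::
    "nat \<Rightarrow> ('x, 'q, 'r) mechanism \<Rightarrow> 'x list pmf \<Rightarrow> 'q \<Rightarrow> 'x list \<Rightarrow> 'r \<Rightarrow> real" where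
  "prob_s_given_r n M D q s r = pmf D s * pmf (M s q) r / prob_r n M D q r"

definition prob_x_given_s :: "nat \<Rightarrow> 'x \<Rightarrow> 'x list \<Rightarrow> real" where
  "prob_x_given_s n x s = real (card {i. i < n \<and> s ! i = x}) / real n"

definition prob_x :: "nat \<Rightarrow> 'x list pmf \<Rightarrow> 'x \<Rightarrow> real" where
  "prob_x n D x = (\<Sum>\<^sub>\<infinity>s\<in>samples n. pmf D s * prob_x_given_s n x s)"

definition prob_x_given_r ::
    "nat \<Rightarrow> ('x, 'q, 'r) mechanism \<Rightarrow> 'x list pmf \<Rightarrow> 'q \<Rightarrow> 'x \<Rightarrow> 'r \<Rightarrow> real" where
  "prob_x_given_r n M D q x r =
     (\<Sum>\<^sub>\<infinity>s\<in>samples n. prob_s_given_r n M D q s r * prob_x_given_s n x s)"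

definition stability_loss ::
    "nat \<Rightarrow> ('x, 'q, 'r) mechanism \<Rightarrow> 'x list pmf \<Rightarrow> 'q \<Rightarrow> 'r \<Rightarrow> real" where
  "stability_loss n M D q r =
     (\<Sum>\<^sub>\<infinity>x\<in>{x. prob_x_given_r n M D q x r > prob_x n D x}.
        prob_x_given_r n M D q x r - prob_x n D x)"

text \<open>Local statistical stability; \<open>D\<close> is meant to be supported on \<^term>\<open>samples n\<close>.\<close>

definition LSS ::
    "nat \<Rightarrow> ('x, 'q, 'r) mechanism \<Rightarrow> real \<Rightarrow> real \<Rightarrow> 'x list pmf \<Rightarrow> 'q \<Rightarrow> bool" where
  "LSS n M \<epsilon> \<delta> D q \<longleftrightarrow>
     (\<forall>R. (\<Sum>\<^sub>\<infinity>r\<in>R. prob_r n M D q r * (stability_loss n M D q r - \<epsilon>)) \<le> \<delta>)"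

end

theory Submission
  imports Defs
begin

text \<open>
  Let \<open>A r\<close> be the set of elements whose probability increases on seeing \<open>r\<close>. Then
  \<open>D(r) \<ell>(r)\<close> is the expectation over \<open>s\<close> of \<open>D(r | s)\<close> times the excess of the empirical
  frequency of \<open>A r\<close> in \<open>s\<close> over its true probability. Hence the LSS sum is at most the
  probability that this excess is larger than \<open>\<epsilon>\<close>.

  The response depends on the sample only through a subsample \<open>t\<close> of size \<open>m\<close>. A union bound
  over the at most \<open>n ^ m\<close> choices of positions of \<open>t\<close> reduces to the case in which \<open>t\<close> sits at
  fixed positions. There the other \<open>n - m\<close> entries are independent of \<open>t\<close> and \<open>r\<close>, and
  Hoeffding's inequality applies to them.
\<close>

section \<open>Probabilities of \<open>bind_pmf\<close>, infinite sums and posteriors\<close>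

lemma measure_bind_pmf_eq:
  "measure_pmf.prob (bind_pmf p k) B = measure_pmf.expectation p (\<lambda>x. measure_pmf.prob (k x) B)"
proof -
  have int: "integrable p (\<lambda>x. measure_pmf.prob (k x) B)"
    by (intro measure_pmf.integrable_const_bound[where B = 1]) auto
  have "ennreal (measure_pmf.prob (bind_pmf p k) B) = emeasure (bind_pmf p k) B"
    by (rule measure_pmf.emeasure_eq_measure[symmetric])
  also have "\<dots> = (\<integral>\<^sup>+x. ennreal (measure_pmf.prob (k x) B) \<partial>p)"
    unfolding emeasure_bind_pmf by (intro nn_integral_cong measure_pmf.emeasure_eq_measure)
  also have "\<dots> = ennreal (measure_pmf.expectation p (\<lambda>x. measure_pmf.prob (k x) B))"
    using int by (intro nn_integral_eq_integral) auto
  finally show ?thesis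
    by (simp add: integral_nonneg_AE)
qed

lemma prob_bind_pmf_le:
  assumes "\<And>x. x \<in> set_pmf p \<Longrightarrow> measure_pmf.prob (k x) B \<le> c"
  shows "measure_pmf.prob (bind_pmf p k) B \<le> c"
proof -
  have "measure_pmf.expectation p (\<lambda>x. measure_pmf.prob (k x) B) \<le> measure_pmf.expectation p (\<lambda>x. c)"
    using assms
    by (intro integral_mono_AE measure_pmf.integrable_const_bound[where B = 1] measure_pmf.integrable_const)
       (auto simp: AE_measure_pmf_iff)
  then show ?thesis
    by (simp add: measure_bind_pmf_eq)
qed

text \<open>For real functions summability and absolute summability coincide, and where they fail
  both sums default to 0. This links facts about pmfs, stated with \<open>infsetsum\<close>, to the
  definitions, which use \<open>infsum\<close>.\<close>

lemma infsetsum_eq_infsum_real: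
  fixes f :: "'a \<Rightarrow> real"
  shows "infsetsum f A = infsum f A"
proof (cases "Infinite_Set_Sum.abs_summable_on f A")
  case True
  then show ?thesis by (rule infsetsum_infsum)
next
  case False
  then have "\<not> f summable_on A"
    using abs_summable_equivalent summable_on_iff_abs_summable_on_real by blast
  with False show ?thesis
    by (simp add: not_summable_infsetsum_eq infsum_not_exists)
qed

text \<open>Without summability \<open>infsum\<close> is 0, and \<open>F = {}\<close> shows
  \<open>0 \<le> b\<close>. So the LSS sum can be bounded without proving that it converges.\<close>

lemma infsum_le_if_finite_sums_le:
  fixes f :: "'a \<Rightarrow> real"
  assumes "\<And>F. finite F \<Longrightarrow> F \<subseteq> A \<Longrightarrow> sum f F \<le> b"
  shows "infsum f A \<le> b"
proof (cases "f summable_on A")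
  case True
  then show ?thesis using assms by (rule infsum_le_finite_sums)
next
  case False
  then show ?thesis using assms[of "{}"] by (simp add: infsum_not_exists)
qed

lemma infsum_pmf_mult:
  fixes h :: "'a \<Rightarrow> real"
  assumes "set_pmf p \<subseteq> S"
  shows "(\<Sum>\<^sub>\<infinity>s\<in>S. pmf p s * h s) = measure_pmf.expectation p h"
proof -
  have "(\<Sum>\<^sub>\<infinity>s\<in>S. pmf p s * h s) = (\<Sum>\<^sub>\<infinity>s. pmf p s * h s)"
    using assms by (intro infsum_cong_neutral) (auto simp: pmf_eq_0_set_pmf)
  then show ?thesis
    by (simp add: pmf_expectation_eq_infsetsum infsetsum_eq_infsum_real)
qed

lemma infsum_pmf: "infsum (pmf p) A = measure_pmf.prob p A"
  by (simp add: measure_pmf_conv_infsetsum infsetsum_eq_infsum_real)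

lemma pmf_summable_on: "pmf p summable_on A"
  using pmf_abs_summable abs_summable_equivalent summable_on_iff_abs_summable_on_real by blast

text \<open>Bayes' rule: the normalising constant is the total of the joint weights, so the
  quotients sum to 1 and form a pmf.\<close>

lemma obtain_posterior_pmf:
  assumes "pmf (bind_pmf p k) r > 0"
  obtains w where "\<And>s. pmf w s = pmf p s * pmf (k s) r / pmf (bind_pmf p k) r"
proof
  define Z where "Z = pmf (bind_pmf p k) r"
  have Z: "Z > 0" using assms by (simp add: Z_def)
  have "(\<integral>\<^sup>+s. ennreal (pmf p s * pmf (k s) r / Z) \<partial>count_space UNIV)
      = (\<integral>\<^sup>+s. ennreal (pmf p s) * (ennreal (pmf (k s) r) / ennreal Z) \<partial>count_space UNIV)"
    using Z by (intro nn_integral_cong) (simp add: ennreal_mult'' divide_ennreal flip: ennreal_mult')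
  also have "\<dots> = (\<integral>\<^sup>+s. ennreal (pmf (k s) r) / ennreal Z \<partial>p)"
    by (simp add: nn_integral_measure_pmf)
  also have "\<dots> = ennreal Z / ennreal Z"
    by (subst nn_integral_divide) (simp_all add: Z_def ennreal_pmf_bind)
  also have "\<dots> = 1"
    using Z by (simp add: ennreal_divide_self)
  finally have *: "(\<integral>\<^sup>+s. ennreal (pmf p s * pmf (k s) r / Z) \<partial>count_space UNIV) = 1" .
  show "pmf (embed_pmf (\<lambda>s. pmf p s * pmf (k s) r / Z)) s
      = pmf p s * pmf (k s) r / pmf (bind_pmf p k) r" for s
    using * Z by (subst pmf_embed_pmf) (auto simp: Z_def)
qed

section \<open>Exchangeability and the union bound over positions\<close>

text \<open>The probability of a list is the product over its multiset of entries, which a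
  permutation preserves.\<close>

lemma map_pmf_permute_list_replicate_pmf:
  assumes \<sigma>: "\<sigma> permutes {..<n}"
  shows "map_pmf (permute_list \<sigma>) (replicate_pmf n p) = replicate_pmf n p"
proof (rule pmf_eqI)
  fix xs
  have pmf: "pmf (replicate_pmf k p) ys = (if length ys = k then \<Prod>y\<in>#mset ys. pmf p y else 0)" for k ys
  proof (induction k arbitrary: ys)
    case (Suc k)
    have "replicate_pmf (Suc k) p = map_pmf (\<lambda>(x, ys). x # ys) (pair_pmf p (replicate_pmf k p))"
      by (simp add: pair_pmf_def map_bind_pmf)
    moreover have "inj (\<lambda>(x :: 'a, ys). x # ys)"
      by (auto simp: inj_def)
    ultimately have *: "pmf (replicate_pmf (Suc k) p) (z # zs) = pmf p z * pmf (replicate_pmf k p) zs" for z zs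
      using pmf_map_inj'[of "\<lambda>(x :: 'a, ys). x # ys" "pair_pmf p (replicate_pmf k p)" "(z, zs)"]
      by (simp add: pmf_pair)
    show ?case
    proof (cases ys)
      case Nil
      then show ?thesis by (simp add: pmf_eq_0_set_pmf)
    next
      case (Cons z zs)
      show ?thesis unfolding Cons * Suc.IH by simp
    qed
  qed auto
  have inv: "permute_list (inv \<sigma>) (permute_list \<sigma> ys) = ys" if "length ys = n" for ys :: "'a list"
    using that \<sigma> permutes_inv[OF \<sigma>]
    by (metis permute_list_compose permute_list_id permutes_inv_o(1))
  have inv': "permute_list \<sigma> (permute_list (inv \<sigma>) ys) = ys" if "length ys = n" for ys :: "'a list"
    using that \<sigma> permutes_inv[OF \<sigma>]
    by (metis permute_list_compose permute_list_id permutes_inv_o(2))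
  have set: "set (permute_list \<tau> ys) = set ys" if "\<tau> permutes {..<n}" "length ys = n" for \<tau> and ys :: "'a list"
    using that by simp
  show "pmf (map_pmf (permute_list \<sigma>) (replicate_pmf n p)) xs = pmf (replicate_pmf n p) xs"
  \<comment> \<open>Injectivity of \<open>permute_list \<sigma>\<close> is established on the
    support only, so points outside it, where both sides are 0, are treated apart.\<close>
  proof (cases "xs \<in> set_pmf (replicate_pmf n p)")
    case True
    define ys where "ys = permute_list (inv \<sigma>) xs"
    have len: "length xs = n" using True by (simp add: set_replicate_pmf)
    have ys: "ys \<in> set_pmf (replicate_pmf n p)"
      using True set[OF permutes_inv[OF \<sigma>], of xs] by (auto simp: set_replicate_pmf ys_def)
    have inj: "inj_on (permute_list \<sigma>) (set_pmf (replicate_pmf n p))"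
      by (rule inj_on_inverseI[where g = "permute_list (inv \<sigma>)"]) (simp add: inv set_replicate_pmf)
    have "pmf (map_pmf (permute_list \<sigma>) (replicate_pmf n p)) (permute_list \<sigma> ys) = pmf (replicate_pmf n p) ys"
      by (rule pmf_map_inj[OF inj ys])
    also have "\<dots> = pmf (replicate_pmf n p) xs"
      using len mset_permute_list[of "inv \<sigma>" xs] permutes_inv[OF \<sigma>] by (simp add: pmf ys_def)
    finally show ?thesis
      by (simp add: ys_def inv' len)
  next
    case False
    then have "xs \<notin> set_pmf (map_pmf (permute_list \<sigma>) (replicate_pmf n p))"
      using set[OF \<sigma>] by (auto simp: set_replicate_pmf)
    with False show ?thesis by (metis pmf_eq_0_set_pmf)
  qed
qed

lemma obtain_index_permutation:
  assumes "distinct js" "set js \<subseteq> {..<n}"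
  obtains \<sigma> where "\<sigma> permutes {..<n}"
    "\<And>s :: 'a list. length s = n \<Longrightarrow> map ((!) s) js = take (length js) (permute_list \<sigma> s)"
proof -
  define rest where "rest = filter (\<lambda>i. i \<notin> set js) [0..<n]"
  have "mset (js @ rest) = mset [0..<n]"
    using assms by (subst set_eq_iff_mset_eq_distinct[symmetric]) (auto simp: rest_def)
  then obtain \<sigma> where \<sigma>: "\<sigma> permutes {..<n}" "permute_list \<sigma> [0..<n] = js @ rest"
    by (metis mset_eq_permutation length_upt diff_zero)
  have "map ((!) s) js = take (length js) (permute_list \<sigma> s)" if "length s = n" for s :: "'a list"
  proof -
    have "map ((!) s) js = take (length js) (map ((!) s) (permute_list \<sigma> [0..<n]))"
      by (simp add: \<sigma>)
    also have "map ((!) s) (permute_list \<sigma> [0..<n]) = permute_list \<sigma> (map ((!) s) [0..<n])"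
      using \<sigma>(1) by (subst permute_list_map) auto
    also have "map ((!) s) [0..<n] = s"
      using that map_nth by blast
    finally show ?thesis .
  qed
  with \<sigma>(1) show ?thesis by (rule that)
qed

text \<open>Completing \<open>t\<close> to a rearrangement \<open>t @ u\<close> of \<open>s\<close>
  yields a permutation whose first values are the indices. With repeated entries \<open>js\<close>
  is not unique; any choice serves.\<close>

lemma obtain_submultiset_indices:
  assumes "mset t \<subseteq># mset s"
  obtains js where "distinct js" "set js \<subseteq> {..<length s}" "length js = length t" "map ((!) s) js = t"
proof -
  obtain u where "mset u = mset s - mset t"
    using ex_mset by blast
  then have "mset (t @ u) = mset s"
    using assms by simp
  then obtain \<sigma> where \<sigma>: "\<sigma> permutes {..<length s}" "permute_list \<sigma> s = t @ u"
    by (rule mset_eq_permutation)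
  have len: "length t \<le> length s"
    using assms by (metis size_mset size_mset_mono)
  show ?thesis
  proof
    show "distinct (map \<sigma> [0..<length t])"
      using permutes_inj_on[OF \<sigma>(1)] by (simp add: distinct_map)
    show "set (map \<sigma> [0..<length t]) \<subseteq> {..<length s}"
    proof
      fix j assume "j \<in> set (map \<sigma> [0..<length t])"
      then obtain i where "i < length t" "j = \<sigma> i" by auto
      then show "j \<in> {..<length s}"
        using permutes_in_image[OF \<sigma>(1), of i] len by simp
    qed
    have "map ((!) s) (map \<sigma> [0..<length t]) = take (length t) (permute_list \<sigma> s)"
      using len by (simp add: permute_list_def take_map)
    then show "map ((!) s) (map \<sigma> [0..<length t]) = t"
      by (simp add: \<sigma>(2))
  qed simp
qed

text \<open>The union bound for functions: as \<open>h\<close> is nonnegative, its value at the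
  selected \<open>t\<close> is at most its sum over all choices of positions. Exchangeability and
  the symmetry of \<open>h\<close> in the sample make every choice contribute as much as the first
  \<open>m\<close> positions.\<close>

lemma expectation_submultiset_le:
  fixes h :: "'x list \<Rightarrow> 'x list \<Rightarrow> real"
  assumes nonneg: "\<And>s t. 0 \<le> h s t" and le1: "\<And>s t. h s t \<le> 1"
    and sym: "\<And>s s' t. mset s = mset s' \<Longrightarrow> h s t = h s' t"
    and g: "\<And>s t. length s = n \<Longrightarrow> t \<in> set_pmf (g s) \<Longrightarrow> length t = m \<and> mset t \<subseteq># mset s"
  shows "measure_pmf.expectation (replicate_pmf n p) (\<lambda>s. measure_pmf.expectation (g s) (h s))
    \<le> real n ^ m * measure_pmf.expectation (replicate_pmf n p) (\<lambda>s. h s (take m s))"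
proof -
  let ?D = "replicate_pmf n p"
  define J where "J = {js. set js \<subseteq> {..<n} \<and> length js = m \<and> distinct js}"
  have "J \<subseteq> {js. set js \<subseteq> {..<n} \<and> length js = m}"
    by (auto simp: J_def)
  then have J: "finite J" "card J \<le> n ^ m"
    using card_mono[of "{js. set js \<subseteq> {..<n} \<and> length js = m}" J]
      finite_lists_length_eq[of "{..<n}" m] card_lists_length_eq[of "{..<n}" m]
    by (auto intro: finite_subset)
  have int: "integrable ?D (\<lambda>s. h s (k s))" for k
    using nonneg le1 by (intro measure_pmf.integrable_const_bound[where B = 1]) auto
  have int': "integrable (g s) (h s)" for s
    using nonneg le1 by (intro measure_pmf.integrable_const_bound[where B = 1]) auto
  have len: "length s = n" if "s \<in> set_pmf ?D" for s
    using that by (simp add: set_replicate_pmf)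
  have "measure_pmf.expectation (g s) (h s) \<le> (\<Sum>js\<in>J. h s (map ((!) s) js))" if "length s = n" for s
  proof -
    have "h s t \<le> (\<Sum>js\<in>J. h s (map ((!) s) js))" if t: "t \<in> set_pmf (g s)" for t
    proof -
      from g[OF \<open>length s = n\<close> t] obtain js where "js \<in> J" "map ((!) s) js = t"
        by (metis (mono_tags, lifting) J_def \<open>length s = n\<close> mem_Collect_eq obtain_submultiset_indices)
      then show ?thesis
        using member_le_sum[of js J "\<lambda>js. h s (map ((!) s) js)"] J nonneg by simp
    qed
    then have "measure_pmf.expectation (g s) (h s)
        \<le> measure_pmf.expectation (g s) (\<lambda>_. \<Sum>js\<in>J. h s (map ((!) s) js))"
      by (intro integral_mono_AE int') (auto simp: AE_measure_pmf_iff)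
    then show ?thesis by simp
  qed
  then have le_sum: "AE s in ?D. measure_pmf.expectation (g s) (h s) \<le> (\<Sum>js\<in>J. h s (map ((!) s) js))"
    using len by (simp add: AE_measure_pmf_iff)
  have "0 \<le> measure_pmf.expectation (g s) (h s)" "measure_pmf.expectation (g s) (h s) \<le> 1" for s
    by (simp_all add: nonneg le1 integral_nonneg_AE measure_pmf.integral_le_const int')
  then have "integrable ?D (\<lambda>s. measure_pmf.expectation (g s) (h s))"
    by (intro measure_pmf.integrable_const_bound[where B = 1]) simp_all
  then have "measure_pmf.expectation ?D (\<lambda>s. measure_pmf.expectation (g s) (h s))
      \<le> measure_pmf.expectation ?D (\<lambda>s. \<Sum>js\<in>J. h s (map ((!) s) js))"
    by (intro integral_mono_AE Bochner_Integration.integrable_sum int le_sum)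
  also have "\<dots> = (\<Sum>js\<in>J. measure_pmf.expectation ?D (\<lambda>s. h s (map ((!) s) js)))"
    by (intro Bochner_Integration.integral_sum int)
  also have "\<dots> = (\<Sum>js\<in>J. measure_pmf.expectation ?D (\<lambda>s. h s (take m s)))"
  proof (intro sum.cong refl)
    fix js assume js: "js \<in> J"
    obtain \<sigma> where \<sigma>: "\<sigma> permutes {..<n}"
      "\<And>s :: 'x list. length s = n \<Longrightarrow> map ((!) s) js = take (length js) (permute_list \<sigma> s)"
      using js by (auto simp: J_def intro: obtain_index_permutation[of js n])
    \<comment> \<open>By \<open>sym\<close> the sample in the first argument may be permuted as
      well; then both arguments depend on \<open>permute_list \<sigma> s\<close> alone, which is
      distributed like \<open>s\<close>.\<close>
    have "measure_pmf.expectation ?D (\<lambda>s. h s (map ((!) s) js))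
        = measure_pmf.expectation ?D (\<lambda>s. h (permute_list \<sigma> s) (take m (permute_list \<sigma> s)))"
    proof (intro integral_cong_AE)
      show "AE s in ?D. h s (map ((!) s) js) = h (permute_list \<sigma> s) (take m (permute_list \<sigma> s))"
        using \<sigma> js len sym[OF mset_permute_list] by (auto simp: AE_measure_pmf_iff J_def)
    qed auto
    also have "\<dots> = measure_pmf.expectation (map_pmf (permute_list \<sigma>) ?D) (\<lambda>s. h s (take m s))"
      by simp
    finally show "measure_pmf.expectation ?D (\<lambda>s. h s (map ((!) s) js))
        = measure_pmf.expectation ?D (\<lambda>s. h s (take m s))"
      by (simp add: map_pmf_permute_list_replicate_pmf[OF \<sigma>(1)])
  qed
  also have "\<dots> = real (card J) * measure_pmf.expectation ?D (\<lambda>s. h s (take m s))"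
    by simp
  also have "\<dots> \<le> real n ^ m * measure_pmf.expectation ?D (\<lambda>s. h s (take m s))"
    using J nonneg by (intro mult_right_mono) (auto simp: integral_nonneg_AE simp flip: of_nat_power)
  finally show ?thesis .
qed

section \<open>Hoeffding's inequality for counts in i.i.d. samples\<close>

text \<open>Membership of the entries in \<open>A\<close> is a sequence of independent Bernoulli
  trials, and the count is its number of successes.\<close>

lemma map_filter_replicate_pmf:
  "map_pmf (\<lambda>u. length (filter (\<lambda>x. x \<in> A) u)) (replicate_pmf k p)
    = binomial_pmf k (measure_pmf.prob p A)"
proof -
  have eq: "map_pmf (\<lambda>x. x \<in> A) p = bernoulli_pmf (measure_pmf.prob p A)"
  proof (rule pmf_eqI)
    fix b
    have "(\<lambda>x. x \<in> A) -` {False} = UNIV - A" by auto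
    moreover have "(\<lambda>x. x \<in> A) -` {True} = A" by auto
    ultimately show "pmf (map_pmf (\<lambda>x. x \<in> A) p) b = pmf (bernoulli_pmf (measure_pmf.prob p A)) b"
      using measure_pmf.prob_compl[of A p] by (cases b) (auto simp: pmf_map)
  qed
  have "map_pmf (map f) (replicate_pmf k p) = replicate_pmf k (map_pmf f p)" for f :: "'a \<Rightarrow> bool"
  proof (induction k)
    case (Suc k)
    show ?case by (simp add: map_bind_pmf bind_map_pmf flip: Suc)
  qed simp
  then have "binomial_pmf k (measure_pmf.prob p A)
      = map_pmf (length \<circ> filter id) (map_pmf (map (\<lambda>x. x \<in> A)) (replicate_pmf k p))"
    by (subst binomial_pmf_altdef) (auto simp: eq)
  then show ?thesis
    by (simp add: pmf.map_comp o_def filter_map)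
qed

lemma prob_count_replicate_pmf_ge:
  assumes "k > 0" "c \<ge> 0"
  shows "measure_pmf.prob (replicate_pmf k p)
      {u. real (length (filter (\<lambda>x. x \<in> A) u)) \<ge> k * measure_pmf.prob p A + c} \<le> exp (- 2 * c\<^sup>2 / k)"
proof -
  interpret binomial_distribution k "measure_pmf.prob p A"
    by unfold_locales auto
  show ?thesis
    using prob_ge[OF assms] unfolding map_filter_replicate_pmf[symmetric] by (simp add: vimage_def)
qed

section \<open>Empirical distribution and stability loss\<close>

text \<open>The law of an entry at a uniformly random position. As a pmf it lets \<open>D(x)\<close>
  and \<open>D(x | r)\<close> be written through \<open>bind_pmf\<close>: draw a sample, then one of
  its entries.\<close>

definition empirical_pmf :: "nat \<Rightarrow> 'a list \<Rightarrow> 'a pmf" where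
  "empirical_pmf n s = map_pmf ((!) s) (pmf_of_set {..<n})"

lemma measure_empirical_pmf:
  assumes "length s = n" "n > 0"
  shows "measure_pmf.prob (empirical_pmf n s) A = length (filter (\<lambda>x. x \<in> A) s) / n"
proof -
  have "{..<n} \<noteq> {}" using assms by auto
  then show ?thesis
    using assms
    by (auto simp: empirical_pmf_def measure_pmf_of_set length_filter_conv_card
        intro!: arg_cong[where f = card])
qed

lemma prob_x_given_s_eq:
  assumes "n > 0"
  shows "prob_x_given_s n x s = pmf (empirical_pmf n s) x"
proof -
  have "{..<n} \<noteq> {}" using assms by auto
  then show ?thesis
    by (auto simp: empirical_pmf_def prob_x_given_s_def pmf_map measure_pmf_of_set
        intro!: arg_cong[where f = card])
qed

lemma map_nth_replicate_pmf: "i < n \<Longrightarrow> map_pmf (\<lambda>s. s ! i) (replicate_pmf n p) = p"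
proof (induction n arbitrary: i)
  case (Suc n)
  then show ?case
    by (cases i) (simp_all add: map_bind_pmf bind_return_pmf' pmf.map_comp o_def flip: map_pmf_def)
qed simp

text \<open>Drawing the position before the sample leaves a single coordinate, which has law
  \<open>p\<close>.\<close>

lemma bind_empirical_replicate_pmf:
  assumes "n > 0"
  shows "bind_pmf (replicate_pmf n p) (empirical_pmf n) = p"
proof -
  have "bind_pmf (replicate_pmf n p) (empirical_pmf n)
      = bind_pmf (pmf_of_set {..<n}) (\<lambda>i. map_pmf (\<lambda>s. s ! i) (replicate_pmf n p))"
    unfolding empirical_pmf_def[abs_def] map_pmf_def by (rule bind_commute_pmf)
  also have "\<dots> = bind_pmf (pmf_of_set {..<n}) (\<lambda>_. p)"
  proof (intro bind_pmf_cong refl)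
    have "{..<n} \<noteq> {}" using assms by auto
    then show "map_pmf (\<lambda>s. s ! i) (replicate_pmf n p) = p" if "i \<in> set_pmf (pmf_of_set {..<n})" for i
      using that by (simp add: map_nth_replicate_pmf)
  qed
  finally show ?thesis by simp
qed

lemma prob_r_eq:
  "prob_r n M (replicate_pmf n p) q r = pmf (bind_pmf (replicate_pmf n p) (\<lambda>s. M s q)) r"
  unfolding prob_r_def pmf_bind
  by (rule infsum_pmf_mult) (auto simp: set_replicate_pmf samples_def)

lemma prob_x_eq:
  assumes "n > 0"
  shows "prob_x n (replicate_pmf n p) x = pmf p x"
proof -
  have "prob_x n (replicate_pmf n p) x = pmf (bind_pmf (replicate_pmf n p) (empirical_pmf n)) x"
    unfolding prob_x_def pmf_bind prob_x_given_s_eq[OF assms]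
    by (rule infsum_pmf_mult) (auto simp: set_replicate_pmf samples_def)
  then show ?thesis
    by (simp add: bind_empirical_replicate_pmf assms)
qed

text \<open>On \<open>A\<close> the summed differences are a difference of two probabilities of
  \<open>A\<close>, the first averaged over the posterior of the sample. Multiplication by
  \<open>D(r)\<close> cancels the normalisation of that posterior.\<close>

lemma prob_r_mult_stability_loss:
  fixes p :: "'x pmf" and M :: "('x, 'q, 'r) mechanism" and q :: 'q and r :: 'r
  assumes "n > 0"
  defines "D \<equiv> replicate_pmf n p"
  defines "A \<equiv> {x. prob_x_given_r n M D q x r > prob_x n D x}"
  shows "prob_r n M D q r * stability_loss n M D q r
    = measure_pmf.expectation D
        (\<lambda>s. pmf (M s q) r * (measure_pmf.prob (empirical_pmf n s) A - measure_pmf.prob p A))"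
proof -
  define Z where "Z = prob_r n M D q r"
  have Z: "Z = pmf (bind_pmf D (\<lambda>s. M s q)) r"
    by (simp add: Z_def D_def prob_r_eq)
  have D: "set_pmf D \<subseteq> samples n"
    by (auto simp: D_def set_replicate_pmf samples_def)
  show ?thesis
  proof (cases "Z = 0")
    \<comment> \<open>A response of probability 0 has probability 0 on every sample in the support,
      so both sides vanish whatever the loss is.\<close>
    case True
    then have "pmf (M s q) r = 0" if "s \<in> set_pmf D" for s
      using that by (auto simp: Z pmf_eq_0_set_pmf)
    then have "measure_pmf.expectation D
        (\<lambda>s. pmf (M s q) r * (measure_pmf.prob (empirical_pmf n s) A - measure_pmf.prob p A)) = 0"
      by (intro integral_eq_zero_AE) (auto simp: AE_measure_pmf_iff)
    with True show ?thesis
      by (simp add: Z_def)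
  next
    case False
    then have pos: "pmf (bind_pmf D (\<lambda>s. M s q)) r > 0"
      using Z by (metis pmf_pos)
    \<comment> \<open>\<open>w\<close> is the posterior \<open>D(s | r)\<close>.\<close>
    obtain w where w: "\<And>s. pmf w s = pmf D s * pmf (M s q) r / Z"
      using obtain_posterior_pmf[OF pos] unfolding Z by blast
    have w_D: "set_pmf w \<subseteq> set_pmf D"
      by (auto simp: set_pmf_iff w)
    have x: "prob_x_given_r n M D q x r = pmf (bind_pmf w (empirical_pmf n)) x" for x
      unfolding prob_x_given_r_def prob_s_given_r_def pmf_bind prob_x_given_s_eq[OF assms(1)]
        Z_def[symmetric] w[symmetric]
      using w_D D by (intro infsum_pmf_mult) auto
    have prob_D: "prob_x n D x = pmf p x" for x
      unfolding D_def by (rule prob_x_eq[OF assms(1)])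
    have "stability_loss n M D q r
        = (\<Sum>\<^sub>\<infinity>x\<in>A. pmf (bind_pmf w (empirical_pmf n)) x - pmf p x)"
      unfolding stability_loss_def A_def[symmetric]
      by (simp add: x prob_D)
    also have "\<dots> = measure_pmf.prob (bind_pmf w (empirical_pmf n)) A - measure_pmf.prob p A"
    proof -
      have "((\<lambda>x. pmf (bind_pmf w (empirical_pmf n)) x + - pmf p x) has_sum
          (measure_pmf.prob (bind_pmf w (empirical_pmf n)) A + - measure_pmf.prob p A)) A"
        unfolding infsum_pmf[symmetric]
        by (intro has_sum_add has_sum_infsum pmf_summable_on has_sum_uminusI)
      then show ?thesis by (simp add: infsumI)
    qed
    also have "\<dots> = measure_pmf.expectation w
        (\<lambda>s. measure_pmf.prob (empirical_pmf n s) A - measure_pmf.prob p A)"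
      unfolding measure_bind_pmf_eq
      by (subst Bochner_Integration.integral_diff)
         (auto intro!: measure_pmf.integrable_const_bound[where B = 1])
    also have "\<dots> = (\<Sum>\<^sub>\<infinity>s. pmf D s * (pmf (M s q) r *
        (measure_pmf.prob (empirical_pmf n s) A - measure_pmf.prob p A) / Z))"
      by (subst infsum_pmf_mult[of _ UNIV, symmetric]) (simp_all add: w mult.assoc)
    also have "\<dots> = measure_pmf.expectation D
        (\<lambda>s. pmf (M s q) r * (measure_pmf.prob (empirical_pmf n s) A - measure_pmf.prob p A)) / Z"
      by (subst infsum_pmf_mult) simp_all
    finally show ?thesis
      using False by (simp add: Z_def)
  qed
qed

section \<open>Stability of compression schemes\<close>

text \<open>Given the first \<open>m\<close> entries and the response, \<open>A r\<close> is a fixed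
  set and the other \<open>n - m\<close> entries are still i.i.d., so Hoeffding's inequality applies
  to them. The summand \<open>m\<close> in the threshold pays for the first entries, all of which
  may lie in \<open>A r\<close>.\<close>

lemma expectation_prob_take_deviation_le:
  fixes f :: "'x list \<Rightarrow> 'r pmf" and A :: "'r \<Rightarrow> 'x set"
  assumes "m < n" "c \<ge> 0"
  shows "measure_pmf.expectation (replicate_pmf n p) (\<lambda>s. measure_pmf.prob (f (take m s))
      {r. real (length (filter (\<lambda>x. x \<in> A r) s)) \<ge> m + real (n - m) * measure_pmf.prob p (A r) + c})
    \<le> exp (- 2 * c\<^sup>2 / real (n - m))"
proof -
  define k where "k = n - m"
  define B where "B = {(s, r). real (length (filter (\<lambda>x. x \<in> A r) s)) \<ge> m + real k * measure_pmf.prob p (A r) + c}"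
  have n: "n = m + k" and k: "k > 0"
    using assms(1) by (simp_all add: k_def)
  have "measure_pmf.expectation (replicate_pmf n p) (\<lambda>s. measure_pmf.prob (f (take m s)) {r. (s, r) \<in> B})
      = measure_pmf.prob (bind_pmf (replicate_pmf n p) (\<lambda>s. map_pmf (Pair s) (f (take m s)))) B"
    by (simp add: measure_bind_pmf_eq vimage_def)
  also have "bind_pmf (replicate_pmf n p) (\<lambda>s. map_pmf (Pair s) (f (take m s)))
      = bind_pmf (replicate_pmf m p) (\<lambda>t. bind_pmf (replicate_pmf k p) (\<lambda>u. map_pmf (Pair (t @ u)) (f t)))"
    unfolding n replicate_pmf_distrib bind_assoc_pmf bind_return_pmf
    by (intro bind_pmf_cong refl) (auto simp: set_replicate_pmf)
  \<comment> \<open>Since \<open>f t\<close> does not see \<open>u\<close>, the response can be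
    drawn first; this fixes \<open>A r\<close> before \<open>u\<close> is drawn.\<close>
  also have "\<dots> = bind_pmf (replicate_pmf m p)
      (\<lambda>t. bind_pmf (f t) (\<lambda>r. map_pmf (\<lambda>u. (t @ u, r)) (replicate_pmf k p)))"
    unfolding map_pmf_def by (intro bind_pmf_cong refl bind_commute_pmf)
  also have "measure_pmf.prob \<dots> B \<le> exp (- 2 * c\<^sup>2 / k)"
  proof (intro prob_bind_pmf_le)
    fix t r assume "t \<in> set_pmf (replicate_pmf m p)"
    then have "length (filter (\<lambda>x. x \<in> A r) t) \<le> m"
      using length_filter_le[of _ t] by (simp add: set_replicate_pmf)
    then have "measure_pmf.prob (map_pmf (\<lambda>u. (t @ u, r)) (replicate_pmf k p)) B
        \<le> measure_pmf.prob (replicate_pmf k p)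
            {u. real (length (filter (\<lambda>x. x \<in> A r) u)) \<ge> k * measure_pmf.prob p (A r) + c}"
      by (auto simp: B_def intro!: measure_pmf.finite_measure_mono)
    also have "\<dots> \<le> exp (- 2 * c\<^sup>2 / k)"
      using k assms(2) by (rule prob_count_replicate_pmf_ge)
    finally show "measure_pmf.prob (map_pmf (\<lambda>u. (t @ u, r)) (replicate_pmf k p)) B \<le> exp (- 2 * c\<^sup>2 / k)" .
  qed
  finally show ?thesis
    by (simp add: B_def k_def)
qed

text \<open>Here \<open>c\<close> is the deviation in Hoeffding's inequality, and
  \<open>m + c \<le> n * \<epsilon>\<close> makes every response with excess frequency above
  \<epsilon> bad. The hypothesis on \<delta> is the union bound times the tail bound.\<close>

lemma LSS_if_compression_scheme:
  fixes M :: "('x, 'q, 'r) mechanism"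
  assumes scheme: "has_compression_scheme n M m q"
    and c: "c \<ge> 0" "m + c \<le> n * \<epsilon>" and \<delta>: "real n ^ m * exp (- 2 * c\<^sup>2 / real (n - m)) \<le> \<delta>"
  shows "LSS n M \<epsilon> \<delta> (replicate_pmf n p) q"
proof -
  define D where "D = replicate_pmf n p"
  define A where "A r = {x. prob_x_given_r n M D q x r > prob_x n D x}" for r
  define bad where "bad s = {r. real (length (filter (\<lambda>x. x \<in> A r) s))
      \<ge> m + real (n - m) * measure_pmf.prob p (A r) + c}" for s
  from scheme have mn: "m < n" and n: "n > 0"
    by (auto simp: has_compression_scheme_def)
  from scheme obtain g f where
    gM: "\<forall>s\<in>samples n. (\<forall>t\<in>set_pmf (g s). t \<in> samples m \<and> mset t \<subseteq># mset s) \<and> M s q = bind_pmf (g s) f"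
    unfolding has_compression_scheme_def by blast
  then have g: "length t = m \<and> mset t \<subseteq># mset s" if "length s = n" "t \<in> set_pmf (g s)" for s t
    using that by (simp add: samples_def)
  have M: "M s q = bind_pmf (g s) f" if "length s = n" for s
    using gM that by (simp add: samples_def)
  have "real n * \<epsilon> \<ge> 0"
    using c by linarith
  then have "\<epsilon> \<ge> 0"
    using n by (simp add: zero_le_mult_iff)
  have len: "length s = n" if "s \<in> set_pmf D" for s
    using that by (simp add: D_def set_replicate_pmf)
  have prob_bad: "measure_pmf.expectation D (\<lambda>s. measure_pmf.prob (M s q) (bad s)) \<le> \<delta>"
  proof -
    have "measure_pmf.expectation D (\<lambda>s. measure_pmf.prob (M s q) (bad s))
        = measure_pmf.expectation D (\<lambda>s. measure_pmf.expectation (g s) (\<lambda>t. measure_pmf.prob (f t) (bad s)))"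
      by (intro integral_cong_AE) (auto simp: AE_measure_pmf_iff M len measure_bind_pmf_eq)
    also have "\<dots> \<le> real n ^ m * measure_pmf.expectation D (\<lambda>s. measure_pmf.prob (f (take m s)) (bad s))"
      unfolding D_def
    \<comment> \<open>The event \<open>bad s\<close> depends on \<open>s\<close> only through
      counts, which gives the required symmetry.\<close>
    proof (rule expectation_submultiset_le[OF _ _ _ g])
      fix s s' :: "'x list" and t assume "mset s = mset s'"
      then have "length (filter P s) = length (filter P s')" for P
        by (metis mset_filter size_mset)
      then show "measure_pmf.prob (f t) (bad s) = measure_pmf.prob (f t) (bad s')"
        by (simp add: bad_def)
    qed auto
    also have "\<dots> \<le> real n ^ m * exp (- 2 * c\<^sup>2 / real (n - m))"
      unfolding D_def bad_def
      by (intro mult_left_mono expectation_prob_take_deviation_le mn c) simp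
    finally show ?thesis
      using \<delta> by simp
  qed
  have response: "prob_r n M D q r * (stability_loss n M D q r - \<epsilon>)
      \<le> measure_pmf.expectation D (\<lambda>s. pmf (M s q) r * indicator (bad s) r)" for r
  proof -
    have int: "integrable D (\<lambda>s. pmf (M s q) r * h s)" if "\<And>s. \<bar>h s\<bar> \<le> 1" for h
      using that
      by (intro measure_pmf.integrable_const_bound[where B = 1])
         (auto simp: abs_mult intro!: mult_le_one pmf_le_1)
    have int_pmf: "integrable D (\<lambda>s. pmf (M s q) r)"
      using int[of "\<lambda>_. 1"] by simp
    have int_diff: "integrable D (\<lambda>s. pmf (M s q) r *
        (measure_pmf.prob (empirical_pmf n s) (A r) - measure_pmf.prob p (A r)))"
    proof (rule int)
      show "\<bar>measure_pmf.prob (empirical_pmf n s) (A r) - measure_pmf.prob p (A r)\<bar> \<le> 1" for s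
        using measure_pmf.prob_le_1[of "empirical_pmf n s" "A r"] measure_pmf.prob_le_1[of p "A r"]
          measure_nonneg[of "empirical_pmf n s" "A r"] measure_nonneg[of p "A r"]
        unfolding abs_le_iff by linarith
    qed
    have "prob_r n M D q r * (stability_loss n M D q r - \<epsilon>)
        = prob_r n M D q r * stability_loss n M D q r - prob_r n M D q r * \<epsilon>"
      by (simp add: algebra_simps)
    also have "prob_r n M D q r * stability_loss n M D q r = measure_pmf.expectation D (\<lambda>s. pmf (M s q) r *
        (measure_pmf.prob (empirical_pmf n s) (A r) - measure_pmf.prob p (A r)))"
      unfolding D_def A_def by (rule prob_r_mult_stability_loss[OF n])
    also have "prob_r n M D q r * \<epsilon> = measure_pmf.expectation D (\<lambda>s. pmf (M s q) r * \<epsilon>)"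
      by (simp add: D_def prob_r_eq pmf_bind)
    also have "measure_pmf.expectation D (\<lambda>s. pmf (M s q) r *
          (measure_pmf.prob (empirical_pmf n s) (A r) - measure_pmf.prob p (A r)))
        - measure_pmf.expectation D (\<lambda>s. pmf (M s q) r * \<epsilon>)
        = measure_pmf.expectation D (\<lambda>s. pmf (M s q) r *
          (measure_pmf.prob (empirical_pmf n s) (A r) - measure_pmf.prob p (A r)) - pmf (M s q) r * \<epsilon>)"
      using int_diff int_pmf by (intro Bochner_Integration.integral_diff[symmetric]) auto
    also have "\<dots> \<le> measure_pmf.expectation D (\<lambda>s. pmf (M s q) r * indicator (bad s) r)"
    proof (intro integral_mono_AE Bochner_Integration.integrable_diff int_diff)
      show "integrable D (\<lambda>s. pmf (M s q) r * indicator (bad s) r)"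
        by (intro int) (simp add: indicator_def)
      have "pmf (M s q) r * (measure_pmf.prob (empirical_pmf n s) (A r) - measure_pmf.prob p (A r)) - pmf (M s q) r * \<epsilon>
          \<le> pmf (M s q) r * indicator (bad s) r" if s: "length s = n" for s
      proof -
        define P where "P = measure_pmf.prob p (A r)"
        define L where "L = real (length (filter (\<lambda>x. x \<in> A r) s))"
        have P: "0 \<le> P" "P \<le> 1" by (auto simp: P_def)
        have E: "measure_pmf.prob (empirical_pmf n s) (A r) = L / n"
          by (simp add: L_def measure_empirical_pmf s n)
        \<comment> \<open>Off \<open>bad s\<close> the choice of \<open>c\<close> makes the left
          side negative; on \<open>bad s\<close> the trivial bound 1 suffices.\<close>
        have "L / n - P - \<epsilon> \<le> indicator (bad s) r"
        proof (cases "r \<in> bad s")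
          case True
          have "L / n \<le> 1"
            using measure_pmf.prob_le_1[of "empirical_pmf n s" "A r"] E by simp
          then show ?thesis
            using True P \<open>\<epsilon> \<ge> 0\<close> by simp
        next
          case False
          then have "L < m + real (n - m) * P + c"
            by (simp add: bad_def L_def P_def)
          also have "\<dots> = real n * P - real m * P + (m + c)"
            using mn by (simp add: of_nat_diff left_diff_distrib)
          also have "\<dots> \<le> real n * P + real n * \<epsilon>"
          proof -
            have "0 \<le> real m * P" using P by simp
            then show ?thesis using c(2) by linarith
          qed
          finally have "L / n < P + \<epsilon>"
            using n by (simp add: field_simps)
          with False show ?thesis by simp
        qed
        then have "pmf (M s q) r * (L / n - P - \<epsilon>) \<le> pmf (M s q) r * indicator (bad s) r"
          by (intro mult_left_mono) auto
        then show ?thesis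
          unfolding E P_def[symmetric] by (simp add: algebra_simps)
      qed
      then show "AE s in D. pmf (M s q) r * (measure_pmf.prob (empirical_pmf n s) (A r) - measure_pmf.prob p (A r)) - pmf (M s q) r * \<epsilon>
          \<le> pmf (M s q) r * indicator (bad s) r"
        using len by (simp add: AE_measure_pmf_iff)
    qed (use int_pmf in auto)
    finally show ?thesis .
  qed
  \<comment> \<open>Finite sums of the indicator bounds add up to at most the probability of a bad
    response.\<close>
  have fin: "(\<Sum>r\<in>F. prob_r n M D q r * (stability_loss n M D q r - \<epsilon>)) \<le> \<delta>" if F: "finite F" for F
  proof -
    have int: "integrable D (\<lambda>s. pmf (M s q) r * indicator (bad s) r)" for r
      by (intro measure_pmf.integrable_const_bound[where B = 1]) (auto simp: indicator_def pmf_le_1)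
    have "(\<Sum>r\<in>F. prob_r n M D q r * (stability_loss n M D q r - \<epsilon>))
        \<le> (\<Sum>r\<in>F. measure_pmf.expectation D (\<lambda>s. pmf (M s q) r * indicator (bad s) r))"
      by (intro sum_mono response)
    also have "\<dots> = measure_pmf.expectation D (\<lambda>s. \<Sum>r\<in>F. pmf (M s q) r * indicator (bad s) r)"
      by (intro Bochner_Integration.integral_sum[symmetric] int)
    also have "\<dots> = measure_pmf.expectation D (\<lambda>s. measure_pmf.prob (M s q) (F \<inter> bad s))"
      using F by (simp add: measure_measure_pmf_finite sum.inter_restrict indicator_def if_distrib cong: if_cong)
    also have "\<dots> \<le> measure_pmf.expectation D (\<lambda>s. measure_pmf.prob (M s q) (bad s))"
      by (intro integral_mono measure_pmf.integrable_const_bound[where B = 1])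
         (auto intro!: measure_pmf.finite_measure_mono)
    finally show ?thesis
      using prob_bad by simp
  qed
  then show ?thesis
    unfolding LSS_def D_def[symmetric] by (blast intro: infsum_le_if_finite_sums_le)
qed

text \<open>The bound on \<open>\<epsilon>\<close> degenerates to \<open>\<epsilon> > 0\<close> for \<open>m = 0\<close>, where Hoeffding's inequality gives nothing.\<close>

lemma LSS_if_compression_scheme_0:
  assumes "has_compression_scheme n M 0 q" "\<epsilon> \<ge> 0" "\<delta> \<ge> 0"
  shows "LSS n M \<epsilon> \<delta> (replicate_pmf n p) q"
proof -
  define D where "D = replicate_pmf n p"
  from assms have n: "n > 0"
    by (auto simp: has_compression_scheme_def)
  from assms obtain g f where
    gM: "\<forall>s\<in>samples n. (\<forall>t\<in>set_pmf (g s). t \<in> samples 0 \<and> mset t \<subseteq># mset s) \<and> M s q = bind_pmf (g s) f"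
    unfolding has_compression_scheme_def by blast
  \<comment> \<open>The only subsample of size 0 is \<open>[]\<close>, so the response is
    independent of the sample.\<close>
  have const: "M s q = f []" if s: "s \<in> set_pmf D" for s
  proof -
    from s have "length s = n" by (simp add: D_def set_replicate_pmf)
    then have "M s q = bind_pmf (g s) f" "\<forall>t\<in>set_pmf (g s). t = []"
      using gM by (auto simp: samples_def)
    then have "M s q = bind_pmf (g s) (\<lambda>_. f [])"
      by (auto intro!: bind_pmf_cong simp del: bind_pmf_const)
    then show ?thesis by simp
  qed
  have zero: "prob_r n M D q r * stability_loss n M D q r = 0" for r
  proof -
    let ?A = "{x. prob_x_given_r n M D q x r > prob_x n D x}"
    have "prob_r n M D q r * stability_loss n M D q r = measure_pmf.expectation D
        (\<lambda>s. pmf (M s q) r * (measure_pmf.prob (empirical_pmf n s) ?A - measure_pmf.prob p ?A))"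
      unfolding D_def by (rule prob_r_mult_stability_loss[OF n])
    also have "\<dots> = measure_pmf.expectation D
        (\<lambda>s. pmf (f []) r * (measure_pmf.prob (empirical_pmf n s) ?A - measure_pmf.prob p ?A))"
      by (intro integral_cong_AE) (auto simp: AE_measure_pmf_iff const)
    \<comment> \<open>The response factors out, and the empirical frequency of \<open>?A\<close>
      averages to its true probability.\<close>
    also have "\<dots> = pmf (f []) r * (measure_pmf.prob (bind_pmf D (empirical_pmf n)) ?A - measure_pmf.prob p ?A)"
      unfolding measure_bind_pmf_eq
      by (subst integral_mult_right_zero, subst Bochner_Integration.integral_diff)
         (auto intro!: measure_pmf.integrable_const_bound[where B = 1])
    finally show ?thesis
      by (simp add: D_def bind_empirical_replicate_pmf n)
  qed
  have "prob_r n M D q r * (stability_loss n M D q r - \<epsilon>) \<le> 0" for r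
    unfolding right_diff_distrib zero using assms(2) by (simp add: D_def prob_r_eq)
  then show ?thesis
    unfolding LSS_def D_def[symmetric]
    using assms(3) by (intro allI infsum_le_if_finite_sums_le) (meson order_trans sum_nonpos)
qed

theorem theorem4p13:
  fixes n m :: nat and \<delta> \<epsilon> :: real
    and D\<^sub>X :: "'x::countable pmf"
    and q :: "'q::countable"
    and M :: "('x, 'q, 'r::countable) mechanism"
  assumes "0 < \<delta>" and "\<delta> \<le> 1"
    and "real m \<le> real n / (9 * ln (2 * real n / \<delta>))"
    and "has_compression_scheme n M m q"
    and "\<epsilon> > 11 * sqrt (real m * ln (2 * real n / \<delta>) / real n)"
  shows "LSS n M \<epsilon> \<delta> (replicate_pmf n D\<^sub>X) q"
proof (cases "m = 0")
  case True
  then show ?thesis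
    using assms by (intro LSS_if_compression_scheme_0) auto
next
  case False
  define L where "L = ln (2 * real n / \<delta>)"
  \<comment> \<open>\<open>S\<close> is \<open>n\<close> times the square root in the bound on
    \<epsilon>, so \<open>n * \<epsilon>\<close> is at least \<open>11 * S\<close>. The value of
    \<open>c\<close> below is the largest with \<open>m + c \<le> n * \<epsilon>\<close>.\<close>
  define S where "S = sqrt (n * (m * L))"
  define c where "c = n * \<epsilon> - m"
  have "real m < n / 2"
    using assms(4) by (simp add: has_compression_scheme_def)
  with False have n: "n \<ge> 3" and mn: "m < n" by auto
  \<comment> \<open>This gives \<open>L \<ge> 1\<close>, from which \<open>m \<le> S\<close>
    follows; subtracting \<open>m\<close> from \<open>n * \<epsilon>\<close> then still leaves at
    least \<open>S\<close>.\<close>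
  have "exp 1 \<le> 2 * real n / \<delta>"
  proof -
    have "exp 1 \<le> (3 :: real)" by (rule exp_le)
    also have "3 \<le> 2 * real n" using n by simp
    also have "\<dots> \<le> 2 * real n / \<delta>" using assms(1,2) n by (simp add: field_simps)
    finally show ?thesis .
  qed
  then have "L \<ge> 1"
    unfolding L_def using assms(1) n by (subst ln_ge_iff) auto
  have S2: "S\<^sup>2 = n * (m * L)"
    using \<open>L \<ge> 1\<close> by (simp add: S_def)
  have "real m * real m \<le> real n * (real m * L)"
    using mult_mono[of "real m" "real n" "real m" "real m * L"] mn \<open>L \<ge> 1\<close>
    by (simp add: mult_le_cancel_left1)
  then have "m \<le> S"
    unfolding S_def by (intro real_le_rsqrt) (simp add: power2_eq_square)
  have "real n * sqrt (real m * L / real n) = S"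
    using n \<open>L \<ge> 1\<close> unfolding S_def
    by (intro real_sqrt_unique[symmetric]) (simp_all add: power_mult_distrib, simp add: power2_eq_square)
  moreover have "real n * (11 * sqrt (real m * L / real n)) \<le> real n * \<epsilon>"
    using assms(5) by (intro mult_left_mono) (simp_all add: L_def)
  ultimately have "11 * S \<le> n * \<epsilon>" by simp
  with \<open>m \<le> S\<close> have cS: "c \<ge> S" and S: "S \<ge> 0" unfolding c_def by linarith+
  have "m * L \<le> S\<^sup>2 / real (n - m)"
    unfolding S2 using mn \<open>L \<ge> 1\<close> by (simp add: field_simps of_nat_diff)
  also have "\<dots> \<le> c\<^sup>2 / real (n - m)"
    using cS S by (intro divide_right_mono power_mono) auto
  also have "\<dots> \<le> 2 * c\<^sup>2 / real (n - m)"
    by (intro divide_right_mono) auto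
  finally have "exp (- 2 * c\<^sup>2 / real (n - m)) \<le> exp (- (m * L))"
    by simp
  \<comment> \<open>The factor \<open>n\<close> inside the logarithm cancels the
    \<open>n ^ m\<close> of the union bound and leaves \<open>(\<delta> / 2) ^ m\<close>.\<close>
  also have "\<dots> = (\<delta> / (2 * n)) ^ m"
    using assms(1) n by (simp add: L_def exp_minus exp_of_nat_mult power_divide field_simps)
  finally have "real n ^ m * exp (- 2 * c\<^sup>2 / real (n - m)) \<le> real n ^ m * (\<delta> / (2 * n)) ^ m"
    by (intro mult_left_mono) auto
  also have "\<dots> = (\<delta> / 2) ^ m"
    using n by (simp flip: power_mult_distrib)
  \<comment> \<open>This needs \<open>m \<ge> 1\<close>, since the power is 1 for
    \<open>m = 0\<close>.\<close>
  also have "\<dots> \<le> (\<delta> / 2) ^ 1"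
    using False assms(1,2) by (intro power_decreasing) auto
  also have "\<dots> \<le> \<delta>"
    using assms(1) by simp
  finally show ?thesis
    using assms(4) cS S by (intro LSS_if_compression_scheme[where c = c]) (auto simp: c_def)
qed

end
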